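(* Consider the one-dimensional moving-mesh semi-discrete finite volume scheme (S1)–(S4) given in the context, for the cell averages $\overline{J\boldsymbol U}_i,\ \overline J_i,\ \overline{J\boldsymbol w}_i,\ \overline{J\boldsymbol q}_i$. The scheme is well-balanced in the following sense. Let it be discretized in time by the forward Euler method or by an explicit strong-stability-preserving (SSP) Runge–Kutta method (the same method being applied to all four equations), and let $C\in\mathbb R$ be a constant. If a steady state is reached at the $n$th time level $t^n$, i.e. $$\overline{\boldsymbol U}_i^{\,n}+\overline{\boldsymbol w}_i^{\,n}=C\,\overline{\boldsymbol q}_i^{\,n}\qquad\forall i,$$ then the numerical solution at $t^{n+1}$ also satisfies $$\overline{\boldsymbol U}_i^{\,n+1}+\overline{\boldsymbol w}_i^{\,n+1}=C\,\overline{\boldsymbol q}_i^{\,n+1}\qquad\forall i .$$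
   Context: **Equations.** 1D shallow water equations with water depth $h\ge 0$, velocity $v_1$, gravity constant $g>0$, time-independent bottom $b$. $\boldsymbol U=(h,hv_1)^\top$, $\boldsymbol F(\boldsymbol U)=(hv_1,\,hv_1^2+\tfrac12 gh^2)^\top$, $\boldsymbol w=(b,0)^\top$, $\boldsymbol q=(1,0)^\top$. The source term $(0,-ghb_x)^\top$ is decomposed as $\sum_{m=1}^2 s_m\,\partial_x\boldsymbol r_m$ with $s_1=-g(h+b)$, $s_2=\tfrac12 g$, $\boldsymbol r_1=(0,b)^\top$, $\boldsymbol r_2=(0,b^2)^\top$. In 1D, $\boldsymbol{\mathcal R}_m=\boldsymbol r_m$. **Mesh.** The computational domain is divided uniformly into cells $I_i=[\xi_{i-1/2},\xi_{i+1/2}]$ of length $\Delta\xi$. A time-dependent map $x=x(t,\xi)$ gives the physical mesh, $J=\partial x/\partial\xi$, and $\dot x_{i+1/2}$ is the given mesh velocity at the node $i+\frac12$. Values outside the domain are supplied by boundary conditions (ghost cells), and "for all $i$" includes these. All cell averages $\overline J_i$ are assumed positive. Physical cell averages are $\overline{\boldsymbol U}_i=\overline{J\boldsymbol U}_i/\overline J_i$, $\overline{\boldsymbol w}_i=\overline{J\boldsymbol w}_i/\overline J_i$, $\overline{\boldsymbol q}_i=\overline{J\boldsymbol q}_i/\overline J_i$. **Quadrature and reconstruction.** $\omega_1,\dots,\omega_Q$ ($\sum_\mu\omega_\mu=1$, $Q=4$) are the Gauss–Lobatto weights; a subscript $i_\mu$ denotes a value at the $\mu$th node of $I_i$, the first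 and last nodes being the cell endpoints. From the cell averages a (fifth-order WENO-based) reconstruction followed by a positivity limiter gives point values $J_{i_\mu}>0$, $\boldsymbol U_{i_\mu}=(h_{i_\mu},(hv_1)_{i_\mu})^\top$ with $h_{i_\mu}\ge0$, $\boldsymbol w_{i_\mu}=(b_{i_\mu},0)^\top$, $\boldsymbol q_{i_\mu}$. The interface traces of each reconstructed quantity $u$ are $u^-_{i+1/2}=u_{i_Q}$ and $u^+_{i-1/2}=u_{i_1}$. The reconstruction (in every time step and every Runge–Kutta stage) has the properties: (i) $\sum_\mu\omega_\mu J_{i_\mu}=\overline J_i$ and $\sum_\mu \omega_\mu J_{i_\mu}\boldsymbol U_{i_\mu}=\overline{J\boldsymbol U}_i$; (ii) if $\overline{\boldsymbol U}_i+\overline{\boldsymbol w}_i=C\overline{\boldsymbol q}_i$ for all $i$, then $\boldsymbol U_{i_\mu}+\boldsymbol w_{i_\mu}=C\boldsymbol q_{i_\mu}$ for all $i,\mu$, and $(hv_1)_{i_\mu}=0$; (iii) $\boldsymbol q$ is initialized as $(1,0)^\top$ and constants are reproduced, so $\boldsymbol q_{i_\mu}=(1,0)^\top$ at all times. Point velocities are computed from $h$ and $hv_1$ by $v_1=(hv_1)/h$ if $h>10^{-4}$ and $v_1=\sqrt2\,h\,(hv_1)/\sqrt{h^4+\max\{h^4,(\Delta\xi)^4\}}$ otherwise (so $v_1=0$ whenever $hv_1=0$). **Notation.** $\{\!\{u\}\!\}_{i+1/2}=\frac12(u^+_{i+1/2}+u^-_{i+1/2})$, $[\![u]\!]_{i+1/2}=u^+_{i+1/2}-u^-_{i+1/2}$;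 $\alpha=\max_i|\dot x_{i+1/2}|$; $\beta_J=\max_i|\dot x_{i+1/2}/J_{i+1/2}|$; $\beta=\max_i(|(\overline v_1)_i|+\sqrt{g\overline h_i})$, where $(\overline v_1)_i$ is the velocity of the cell average $\overline{\boldsymbol U}_i$. $(\overline s_1)_i=-g(\overline h_i+\overline b_i)$, $(\overline s_2)_i=\frac12 g$ (cell averages of $s_m$), $(s_1)_{i_\mu}=-g(h_{i_\mu}+b_{i_\mu})$, $(s_2)_{i_\mu}=\frac12 g$. **Scheme.** (S1) $\displaystyle \frac{d\,\overline{J\boldsymbol U}_i}{dt}=-\frac1{\Delta\xi}\big(\widetilde{\boldsymbol{\mathcal F}}_{i+\frac12}-\widetilde{\boldsymbol{\mathcal F}}_{i-\frac12}\big)+\frac1{\Delta\xi}\sum_{m=1}^2(\overline s_m)_i\big((\widetilde{\boldsymbol{\mathcal R}}_m)_{i+\frac12}-(\widetilde{\boldsymbol{\mathcal R}}_m)_{i-\frac12}\big)+\sum_{\mu=1}^Q\sum_{m=1}^2\omega_\mu\big((s_m)_{i_\mu}-(\overline s_m)_i\big)\Big[\frac{\partial\boldsymbol{\mathcal R}_m}{\partial\xi}\Big]_{i_\mu}$, (S2) $\displaystyle \frac{d\overline J_i}{dt}=-\frac1{\Delta\xi}\Big(\big(J\tfrac{\partial\xi}{\partial t}\big)_{i+\frac12}-\big(J\tfrac{\partial\xi}{\partial t}\big)_{i-\frac12}\Big)$, (S3) $\displaystyle \frac{d\,\overline{J\boldsymbol w}_i}{dt}=-\frac1{\Delta\xi}\big(\widetilde{\boldsymbol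 w}_{i+\frac12}-\widetilde{\boldsymbol w}_{i-\frac12}\big)$, (S4) $\displaystyle \frac{d\,\overline{J\boldsymbol q}_i}{dt}=-\frac1{\Delta\xi}\big(\widetilde{\boldsymbol q}_{i+\frac12}-\widetilde{\boldsymbol q}_{i-\frac12}\big)$, where $[\partial\boldsymbol{\mathcal R}_m/\partial\xi]_{i_\mu}$ is a (finite) numerical approximation of the derivative, and $$\big(J\tfrac{\partial\xi}{\partial t}\big)_{i\pm\frac12}=-\dot x_{i\pm\frac12}-\tfrac{\beta_J}2[\![J]\!]_{i\pm\frac12},\qquad \widetilde{\boldsymbol{\mathcal F}}_{i\pm\frac12}=\big(J\tfrac{\partial\xi}{\partial t}\big)_{i\pm\frac12}\{\!\{\boldsymbol U\}\!\}_{i\pm\frac12}-\tfrac\alpha2[\![\boldsymbol U]\!]_{i\pm\frac12}+\widetilde{\boldsymbol F}_{i\pm\frac12},$$ $$\widetilde{\boldsymbol w}_{i\pm\frac12}=\big(J\tfrac{\partial\xi}{\partial t}\big)_{i\pm\frac12}\{\!\{\boldsymbol w\}\!\}_{i\pm\frac12}-\tfrac\alpha2[\![\boldsymbol w]\!]_{i\pm\frac12},\qquad \widetilde{\boldsymbol q}_{i\pm\frac12}=\big(J\tfrac{\partial\xi}{\partial t}\big)_{i\pm\frac12}\{\!\{\boldsymbol q\}\!\}_{i\pm\frac12}-\tfrac\alpha2[\![\boldsymbol q]\!]_{i\pm\frac12}.$$ In the equation for cell $i$ the flux $\widetilde{\boldsymbol F}$ is (hydrostatic reconstruction) $$\widetilde{\boldsymbol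 F}_{i+\frac12}=\widetilde{\boldsymbol F}\big(\boldsymbol U^{-,*}_{i+\frac12},\boldsymbol U^{+,*}_{i+\frac12}\big)+\Big(0,\ \tfrac g2(h^-_{i+\frac12})^2-\tfrac g2(h^{-,*}_{i+\frac12})^2\Big)^\top,\qquad \widetilde{\boldsymbol F}_{i-\frac12}=\widetilde{\boldsymbol F}\big(\boldsymbol U^{-,*}_{i-\frac12},\boldsymbol U^{+,*}_{i-\frac12}\big)+\Big(0,\ \tfrac g2(h^+_{i-\frac12})^2-\tfrac g2(h^{+,*}_{i-\frac12})^2\Big)^\top,$$ with $\widetilde{\boldsymbol F}(\boldsymbol U_1,\boldsymbol U_2)=\frac12(\boldsymbol F(\boldsymbol U_1)+\boldsymbol F(\boldsymbol U_2))-\frac\beta2(\boldsymbol U_2-\boldsymbol U_1)$ and, at each interface $k+\frac12$, $$h^{\pm,*}_{k+\frac12}=\max\big(0,\ h^\pm_{k+\frac12}+b^\pm_{k+\frac12}-\max(b^+_{k+\frac12},b^-_{k+\frac12})\big),\qquad \boldsymbol U^{\pm,*}_{k+\frac12}=\big(h^{\pm,*}_{k+\frac12},\ h^{\pm,*}_{k+\frac12}(v_1)^\pm_{k+\frac12}\big)^\top.$$ Finally $(\widetilde{\boldsymbol{\mathcal R}}_m)_{i+\frac12}=(\boldsymbol{\mathcal R}_m)^-_{i+\frac12}$ and $(\widetilde{\boldsymbol{\mathcal R}}_m)_{i-\frac12}=(\boldsymbol{\mathcal R}_m)^+_{i-\frac12}$, i.e. $\boldsymbol r_m$ evaluated with $b^-_{i+1/2}$,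 resp. $b^+_{i-1/2}$.
   Formalization: Added assumption: at every stage the boundary conditions give ghost averages satisfying U+w=Cq (and q=(1,0)) whenever all domain cells do; with arbitrary boundary data the claim "for all i", ghost cells included, is false. *)

theory Defs
  imports "HOL-Analysis.Analysis"
begin

text \<open>
  Indexing. The cells of the computational domain are \<open>1, ..., N\<close>, with \<open>G \<ge> 1\<close> ghost cells on
  either side. Interface (node) \<open>k\<close> stands for the half-integer index \<open>k + 1/2\<close>, i.e. the
  interface between cells \<open>k\<close> and \<open>k + 1\<close>; the fluxes of the domain cells use the interfaces
  \<open>0, ..., N\<close> and hence point values in the cells \<open>0, ..., N + 1\<close>.
\<close>

definition domain_cells :: "int \<Rightarrow> int set" where
  "domain_cells N = {1..N}"

definition all_cells :: "int \<Rightarrow> int \<Rightarrow> int set" where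
  "all_cells N G = {1 - G..N + G}"

definition rec_cells :: "int \<Rightarrow> int set" where
  "rec_cells N = {0..N + 1}"

definition interfaces :: "int \<Rightarrow> int set" where
  "interfaces N = {0..N}"

type_synonym vec = "real \<times> real"

text \<open>
  The evolved averages of one cell are the tuple \<open>(JU, J, Jw, Jq)\<close> of averages of
  \<open>J * U\<close>, \<open>J\<close>, \<open>J * w\<close>, \<open>J * q\<close>; as a real vector, so that a time
  integrator acts on all four equations at once.
\<close>

type_synonym averages = "vec \<times> real \<times> vec \<times> vec"

definition avg_JU :: "averages \<Rightarrow> vec" where "avg_JU y = fst y"
definition avg_J :: "averages \<Rightarrow> real" where "avg_J y = fst (snd y)"
definition avg_Jw :: "averages \<Rightarrow> vec" where "avg_Jw y = fst (snd (snd y))"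
definition avg_Jq :: "averages \<Rightarrow> vec" where "avg_Jq y = snd (snd (snd y))"

definition avg_U :: "averages \<Rightarrow> vec" where "avg_U y = avg_JU y /\<^sub>R avg_J y"
definition avg_w :: "averages \<Rightarrow> vec" where "avg_w y = avg_Jw y /\<^sub>R avg_J y"
definition avg_q :: "averages \<Rightarrow> vec" where "avg_q y = avg_Jq y /\<^sub>R avg_J y"

definition steady :: "real \<Rightarrow> averages \<Rightarrow> bool" where
  "steady C y \<longleftrightarrow> avg_U y + avg_w y = C *\<^sub>R avg_q y"

text \<open>
  Output of the reconstruction: \<open>pt_J i \<mu>\<close> etc. are the values at Gauss--Lobatto node \<open>\<mu> = 1, ..., 4\<close>
  of cell \<open>i\<close>; \<open>dR m i \<mu>\<close> is the numerical approximation of the \<open>\<xi>\<close>-derivative of \<open>R\<^sub>m\<close> there, about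
  which nothing is assumed; \<open>J_if k\<close> is the single interface value of \<open>J\<close> that enters \<open>\<beta>\<^sub>J\<close>.
\<close>

record point_values =
  pt_J :: "int \<Rightarrow> nat \<Rightarrow> real"
  pt_U :: "int \<Rightarrow> nat \<Rightarrow> vec"
  pt_w :: "int \<Rightarrow> nat \<Rightarrow> vec"
  pt_q :: "int \<Rightarrow> nat \<Rightarrow> vec"
  dR :: "nat \<Rightarrow> int \<Rightarrow> nat \<Rightarrow> vec"
  J_if :: "int \<Rightarrow> real"

text \<open>Four-point Gauss--Lobatto weights, normalised to total weight 1.\<close>

definition gl_weight :: "nat \<Rightarrow> real" where
  "gl_weight \<mu> = (if \<mu> = 1 \<or> \<mu> = 4 then 1/12 else 5/12)"

definition trace_minus :: "(int \<Rightarrow> nat \<Rightarrow> 'a) \<Rightarrow> int \<Rightarrow> 'a" where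
  "trace_minus u k = u k 4"

definition trace_plus :: "(int \<Rightarrow> nat \<Rightarrow> 'a) \<Rightarrow> int \<Rightarrow> 'a" where
  "trace_plus u k = u (k + 1) 1"

definition mean :: "(int \<Rightarrow> nat \<Rightarrow> 'a::real_vector) \<Rightarrow> int \<Rightarrow> 'a" where
  "mean u k = (1/2) *\<^sub>R (trace_plus u k + trace_minus u k)"

definition jump :: "(int \<Rightarrow> nat \<Rightarrow> 'a::real_vector) \<Rightarrow> int \<Rightarrow> 'a" where
  "jump u k = trace_plus u k - trace_minus u k"

definition velocity :: "real \<Rightarrow> vec \<Rightarrow> real" where
  "velocity d\<xi> U = (let h = fst U; hv = snd U in
     if h > 1 / 10^4 then hv / h
     else sqrt 2 * h * hv / sqrt (h^4 + max (h^4) (d\<xi>^4)))"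

text \<open>
  Properties (i)--(iii) of the reconstruction from the averages \<open>y\<close>, together with the sign
  conditions. The clause on \<open>J_if\<close> admits, in particular, either trace, their minimum and
  their mean as the interface value of \<open>J\<close>.
\<close>

definition reconstruction :: "int \<Rightarrow> int \<Rightarrow> (int \<Rightarrow> averages) \<Rightarrow> point_values \<Rightarrow> bool" where
  "reconstruction N G y P \<longleftrightarrow>
     (\<forall>i\<in>rec_cells N. \<forall>\<mu>\<in>{1..4}. pt_J P i \<mu> > 0 \<and> fst (pt_U P i \<mu>) \<ge> 0 \<and> snd (pt_w P i \<mu>) = 0) \<and>
     (\<forall>i\<in>rec_cells N. (\<Sum>\<mu>=1..4. gl_weight \<mu> * pt_J P i \<mu>) = avg_J (y i) \<and>
        (\<Sum>\<mu>=1..4. (gl_weight \<mu> * pt_J P i \<mu>) *\<^sub>R pt_U P i \<mu>) = avg_JU (y i)) \<and>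
     (\<forall>C. (\<forall>i\<in>all_cells N G. steady C (y i)) \<longrightarrow>
        (\<forall>i\<in>rec_cells N. \<forall>\<mu>\<in>{1..4}.
           pt_U P i \<mu> + pt_w P i \<mu> = C *\<^sub>R pt_q P i \<mu> \<and> snd (pt_U P i \<mu>) = 0)) \<and>
     (\<forall>c. (\<forall>i\<in>all_cells N G. avg_q (y i) = c) \<longrightarrow>
        (\<forall>i\<in>rec_cells N. \<forall>\<mu>\<in>{1..4}. pt_q P i \<mu> = c)) \<and>
     (\<forall>k\<in>interfaces N.
        min (trace_minus (pt_J P) k) (trace_plus (pt_J P) k) \<le> J_if P k \<and>
        J_if P k \<le> max (trace_minus (pt_J P) k) (trace_plus (pt_J P) k))"

definition alpha :: "int \<Rightarrow> (int \<Rightarrow> real) \<Rightarrow> real" where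
  "alpha N xdot = Max ((\<lambda>k. \<bar>xdot k\<bar>) ` interfaces N)"

definition beta_J :: "int \<Rightarrow> (int \<Rightarrow> real) \<Rightarrow> point_values \<Rightarrow> real" where
  "beta_J N xdot P = Max ((\<lambda>k. \<bar>xdot k / J_if P k\<bar>) ` interfaces N)"

definition beta :: "real \<Rightarrow> real \<Rightarrow> int \<Rightarrow> int \<Rightarrow> (int \<Rightarrow> averages) \<Rightarrow> real" where
  "beta g d\<xi> N G y =
     Max ((\<lambda>i. \<bar>velocity d\<xi> (avg_U (y i))\<bar> + sqrt (g * fst (avg_U (y i)))) ` all_cells N G)"

text \<open>The numerical flux for \<open>J * \<partial>\<xi>/\<partial>t\<close>.\<close>

definition J_xi_t :: "int \<Rightarrow> (int \<Rightarrow> real) \<Rightarrow> point_values \<Rightarrow> int \<Rightarrow> real" where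
  "J_xi_t N xdot P k = - xdot k - beta_J N xdot P / 2 * jump (pt_J P) k"

definition mesh_flux ::
  "int \<Rightarrow> (int \<Rightarrow> real) \<Rightarrow> point_values \<Rightarrow> (int \<Rightarrow> nat \<Rightarrow> vec) \<Rightarrow> int \<Rightarrow> vec" where
  "mesh_flux N xdot P u k =
     J_xi_t N xdot P k *\<^sub>R mean u k - (alpha N xdot / 2) *\<^sub>R jump u k"

text \<open>
  \<open>U\<close> and \<open>F(U)\<close> as functions of depth and velocity, so that the flux of a dry state is defined
  without a division and \<open>F(U\<^sup>*)\<close> uses the velocity of the unmodified trace.
\<close>

definition swe_state :: "real \<Rightarrow> real \<Rightarrow> vec" where
  "swe_state h v = (h, h * v)"

definition swe_flux :: "real \<Rightarrow> real \<Rightarrow> real \<Rightarrow> vec" where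
  "swe_flux g h v = (h * v, h * v^2 + 1/2 * g * h^2)"

definition num_flux :: "real \<Rightarrow> real \<Rightarrow> real \<Rightarrow> real \<Rightarrow> real \<Rightarrow> real \<Rightarrow> vec" where
  "num_flux g \<beta> h1 v1 h2 v2 =
     (1/2) *\<^sub>R (swe_flux g h1 v1 + swe_flux g h2 v2)
     - (\<beta>/2) *\<^sub>R (swe_state h2 v2 - swe_state h1 v1)"

definition h_minus :: "point_values \<Rightarrow> int \<Rightarrow> real" where
  "h_minus P k = fst (trace_minus (pt_U P) k)"
definition h_plus :: "point_values \<Rightarrow> int \<Rightarrow> real" where
  "h_plus P k = fst (trace_plus (pt_U P) k)"
definition b_minus :: "point_values \<Rightarrow> int \<Rightarrow> real" where
  "b_minus P k = fst (trace_minus (pt_w P) k)"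
definition b_plus :: "point_values \<Rightarrow> int \<Rightarrow> real" where
  "b_plus P k = fst (trace_plus (pt_w P) k)"

definition h_star_minus :: "point_values \<Rightarrow> int \<Rightarrow> real" where
  "h_star_minus P k = max 0 (h_minus P k + b_minus P k - max (b_plus P k) (b_minus P k))"

definition h_star_plus :: "point_values \<Rightarrow> int \<Rightarrow> real" where
  "h_star_plus P k = max 0 (h_plus P k + b_plus P k - max (b_plus P k) (b_minus P k))"

definition star_flux ::
  "real \<Rightarrow> real \<Rightarrow> int \<Rightarrow> int \<Rightarrow> (int \<Rightarrow> averages) \<Rightarrow> point_values \<Rightarrow> int \<Rightarrow> vec" where
  "star_flux g d\<xi> N G y P k = num_flux g (beta g d\<xi> N G y)
     (h_star_minus P k) (velocity d\<xi> (trace_minus (pt_U P) k))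
     (h_star_plus P k) (velocity d\<xi> (trace_plus (pt_U P) k))"

text \<open>
  The hydrostatic correction makes the flux at an interface differ between its two cells:
  \<open>flux_right i\<close> is the flux at \<open>i + 1/2\<close> in the equation of cell \<open>i\<close>, and \<open>flux_left i\<close> the flux
  at \<open>i - 1/2\<close> (interface \<open>i - 1\<close>) in the same equation.
\<close>

definition flux_right ::
  "real \<Rightarrow> real \<Rightarrow> int \<Rightarrow> int \<Rightarrow> (int \<Rightarrow> real) \<Rightarrow> (int \<Rightarrow> averages) \<Rightarrow> point_values \<Rightarrow> int \<Rightarrow> vec" where
  "flux_right g d\<xi> N G xdot y P i = mesh_flux N xdot P (pt_U P) i +
     (star_flux g d\<xi> N G y P i + (0, g/2 * (h_minus P i)^2 - g/2 * (h_star_minus P i)^2))"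

definition flux_left ::
  "real \<Rightarrow> real \<Rightarrow> int \<Rightarrow> int \<Rightarrow> (int \<Rightarrow> real) \<Rightarrow> (int \<Rightarrow> averages) \<Rightarrow> point_values \<Rightarrow> int \<Rightarrow> vec" where
  "flux_left g d\<xi> N G xdot y P i = mesh_flux N xdot P (pt_U P) (i - 1) +
     (star_flux g d\<xi> N G y P (i - 1)
      + (0, g/2 * (h_plus P (i - 1))^2 - g/2 * (h_star_plus P (i - 1))^2))"

text \<open>Source decomposition \<open>s\<^sub>m\<close>, \<open>R\<^sub>m = r\<^sub>m = (0, b^m)\<close> for \<open>m = 1, 2\<close>.\<close>

definition src :: "real \<Rightarrow> nat \<Rightarrow> real \<Rightarrow> real \<Rightarrow> real" where
  "src g m h b = (if m = 1 then - g * (h + b) else 1/2 * g)"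

definition src_R :: "nat \<Rightarrow> real \<Rightarrow> vec" where
  "src_R m b = (0, b ^ m)"

definition src_avg :: "real \<Rightarrow> nat \<Rightarrow> averages \<Rightarrow> real" where
  "src_avg g m y = src g m (fst (avg_U y)) (fst (avg_w y))"

definition src_pt :: "real \<Rightarrow> nat \<Rightarrow> point_values \<Rightarrow> int \<Rightarrow> nat \<Rightarrow> real" where
  "src_pt g m P i \<mu> = src g m (fst (pt_U P i \<mu>)) (fst (pt_w P i \<mu>))"

text \<open>Right-hand sides of the semi-discrete equations for the averages of cell \<open>i\<close>.\<close>

definition rhs_JU ::
  "real \<Rightarrow> real \<Rightarrow> int \<Rightarrow> int \<Rightarrow> (int \<Rightarrow> real) \<Rightarrow> (int \<Rightarrow> averages) \<Rightarrow> point_values \<Rightarrow> int \<Rightarrow> vec" where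
  "rhs_JU g d\<xi> N G xdot y P i =
     - ((1/d\<xi>) *\<^sub>R (flux_right g d\<xi> N G xdot y P i - flux_left g d\<xi> N G xdot y P i))
     + (1/d\<xi>) *\<^sub>R (\<Sum>m=1..2. src_avg g m (y i) *\<^sub>R
          (src_R m (b_minus P i) - src_R m (b_plus P (i - 1))))
     + (\<Sum>\<mu>=1..4. \<Sum>m=1..2.
          (gl_weight \<mu> * (src_pt g m P i \<mu> - src_avg g m (y i))) *\<^sub>R dR P m i \<mu>)"

definition rhs_J :: "real \<Rightarrow> int \<Rightarrow> (int \<Rightarrow> real) \<Rightarrow> point_values \<Rightarrow> int \<Rightarrow> real" where
  "rhs_J d\<xi> N xdot P i = - (1/d\<xi>) * (J_xi_t N xdot P i - J_xi_t N xdot P (i - 1))"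

definition rhs_Jw :: "real \<Rightarrow> int \<Rightarrow> (int \<Rightarrow> real) \<Rightarrow> point_values \<Rightarrow> int \<Rightarrow> vec" where
  "rhs_Jw d\<xi> N xdot P i =
     - ((1/d\<xi>) *\<^sub>R (mesh_flux N xdot P (pt_w P) i - mesh_flux N xdot P (pt_w P) (i - 1)))"

definition rhs_Jq :: "real \<Rightarrow> int \<Rightarrow> (int \<Rightarrow> real) \<Rightarrow> point_values \<Rightarrow> int \<Rightarrow> vec" where
  "rhs_Jq d\<xi> N xdot P i =
     - ((1/d\<xi>) *\<^sub>R (mesh_flux N xdot P (pt_q P) i - mesh_flux N xdot P (pt_q P) (i - 1)))"

definition rhs ::
  "real \<Rightarrow> real \<Rightarrow> int \<Rightarrow> int \<Rightarrow> (int \<Rightarrow> real) \<Rightarrow> (int \<Rightarrow> averages) \<Rightarrow> point_values \<Rightarrow> int \<Rightarrow> averages" where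
  "rhs g d\<xi> N G xdot y P i =
     (rhs_JU g d\<xi> N G xdot y P i, rhs_J d\<xi> N xdot P i, rhs_Jw d\<xi> N xdot P i, rhs_Jq d\<xi> N xdot P i)"

text \<open>
  Explicit \<open>s\<close>-stage methods in Shu--Osher form
  \<open>Z\<^sub>0 = Y\<^sup>n\<close>, \<open>Z\<^sub>k = (\<Sum>l<k. a k l * Z\<^sub>l + \<Delta>t * c k l * L Z\<^sub>l)\<close>, \<open>Y\<^sup>n\<^sup>+\<^sup>1 = Z\<^sub>s\<close>.
  The method is SSP if every stage is a convex combination of forward Euler steps.
\<close>

definition ssp_runge_kutta :: "nat \<Rightarrow> (nat \<Rightarrow> nat \<Rightarrow> real) \<Rightarrow> (nat \<Rightarrow> nat \<Rightarrow> real) \<Rightarrow> bool" where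
  "ssp_runge_kutta s a c \<longleftrightarrow> s \<ge> 1 \<and>
     (\<forall>k\<in>{1..s}. (\<Sum>l<k. a k l) = 1 \<and>
        (\<forall>l<k. a k l \<ge> 0 \<and> c k l \<ge> 0 \<and> (a k l = 0 \<longrightarrow> c k l = 0)))"

definition forward_euler :: "nat \<Rightarrow> (nat \<Rightarrow> nat \<Rightarrow> real) \<Rightarrow> (nat \<Rightarrow> nat \<Rightarrow> real) \<Rightarrow> bool" where
  "forward_euler s a c \<longleftrightarrow> s = 1 \<and> a 1 0 = 1 \<and> c 1 0 = 1"

text \<open>
  One time step of length \<open>dt\<close> from \<open>y\<close> to \<open>y'\<close> with stages \<open>Z 0, ..., Z s\<close>; stage \<open>k\<close> has point values
  \<open>P k\<close> and mesh velocity \<open>xdot k\<close>. Only domain cells are evolved; the ghost averages of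
  \<open>Z 1, ..., Z s\<close> are left to the boundary conditions.
\<close>

definition time_step ::
  "real \<Rightarrow> real \<Rightarrow> int \<Rightarrow> int \<Rightarrow> nat \<Rightarrow> (nat \<Rightarrow> nat \<Rightarrow> real) \<Rightarrow> (nat \<Rightarrow> nat \<Rightarrow> real) \<Rightarrow> real
   \<Rightarrow> (nat \<Rightarrow> int \<Rightarrow> real) \<Rightarrow> (nat \<Rightarrow> point_values) \<Rightarrow> (nat \<Rightarrow> int \<Rightarrow> averages)
   \<Rightarrow> (int \<Rightarrow> averages) \<Rightarrow> (int \<Rightarrow> averages) \<Rightarrow> bool" where
  "time_step g d\<xi> N G s a c dt xdot P Z y y' \<longleftrightarrow>
     (\<forall>i\<in>all_cells N G. Z 0 i = y i) \<and>
     (\<forall>k\<le>s. \<forall>i\<in>all_cells N G. avg_J (Z k i) > 0) \<and>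
     (\<forall>k<s. reconstruction N G (Z k) (P k)) \<and>
     (\<forall>k\<in>{1..s}. \<forall>i\<in>domain_cells N.
        Z k i = (\<Sum>l<k. a k l *\<^sub>R Z l i
                  + (dt * c k l) *\<^sub>R rhs g d\<xi> N G (xdot l) (Z l) (P l) i)) \<and>
     (\<forall>i\<in>all_cells N G. y' i = Z s i)"

text \<open>
  What is required of the boundary conditions at a stage: the ghost averages they supply share the
  steady-state relation with constant \<open>C\<close>, and the constant \<open>q = (1, 0)\<close>, whenever these hold
  throughout the domain (true for periodic, extrapolation and reflecting conditions). Nothing is
  required when they do not hold in the domain.
\<close>

definition compatible_ghosts :: "int \<Rightarrow> int \<Rightarrow> real \<Rightarrow> (int \<Rightarrow> averages) \<Rightarrow> bool" where
  "compatible_ghosts N G C y \<longleftrightarrow>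
     ((\<forall>i\<in>domain_cells N. steady C (y i)) \<longrightarrow> (\<forall>i\<in>all_cells N G. steady C (y i))) \<and>
     ((\<forall>i\<in>domain_cells N. avg_q (y i) = (1, 0)) \<longrightarrow> (\<forall>i\<in>all_cells N G. avg_q (y i) = (1, 0)))"

end

theory Submission
  imports Defs
begin

text \<open>
  Both relations \<open>q = (1, 0)\<close> and \<open>U + w = C q\<close> are linear conditions on the evolved averages once
  multiplied by \<open>J\<close>, so every stage inherits them as soon as the right-hand side satisfies them.
  For \<open>q = (1, 0)\<close> this is the discrete geometric conservation law. For \<open>U + w = C q\<close>, the mesh
  fluxes are linear in the reconstructed quantity with the same coefficients in all equations, so
  they satisfy the relation; the rest of the right-hand side vanishes, because hydrostatic
  reconstruction turns the flux into \<open>(0, g h\<^sup>2 / 2)\<close>, which with \<open>h = C - b\<close> is balanced by the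
  source differences.
\<close>

section \<open>Linear defects of the two relations\<close>

definition q_defect :: "averages \<Rightarrow> vec" where
  "q_defect y = avg_Jq y - avg_J y *\<^sub>R (1, 0)"

definition steady_defect :: "real \<Rightarrow> averages \<Rightarrow> vec" where
  "steady_defect C y = avg_JU y + avg_Jw y - C *\<^sub>R avg_Jq y"

lemmas avg_defs = avg_JU_def avg_J_def avg_Jw_def avg_Jq_def

lemma linear_q_defect: "linear q_defect"
  by (rule linearI) (simp_all add: q_defect_def avg_defs algebra_simps prod_eq_iff)

lemma linear_steady_defect: "linear (steady_defect C)"
  by (rule linearI) (simp_all add: steady_defect_def avg_defs algebra_simps)

text \<open>Positivity of \<open>avg_J\<close> lets the division be undone. In a cell with
  \<open>avg_J y = 0\<close> all quotients would be 0 by the convention for division by zero and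
  would say nothing about the defect.\<close>

lemma avg_q_eq_iff_q_defect:
  assumes "avg_J y > 0"
  shows "avg_q y = (1, 0) \<longleftrightarrow> q_defect y = 0"
  using assms by (auto simp: avg_q_def q_defect_def prod_eq_iff field_simps)

lemma steady_iff_steady_defect:
  assumes "avg_J y > 0"
  shows "steady C y \<longleftrightarrow> steady_defect C y = 0"
proof -
  have "avg_U y + avg_w y - C *\<^sub>R avg_q y = (1 / avg_J y) *\<^sub>R steady_defect C y"
    by (simp add: avg_U_def avg_w_def avg_q_def steady_defect_def algebra_simps divide_inverse)
  then show ?thesis
    using assms by (auto simp: steady_def eq_iff_diff_eq_0[of "avg_U y + avg_w y"])
qed

section \<open>The right-hand side at the reconstructed values\<close>

lemma reconstruction_q:
  assumes "reconstruction N G y P" and "\<forall>i\<in>all_cells N G. avg_q (y i) = (1, 0)"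
    and "i \<in> rec_cells N" and "\<mu> \<in> {1..4}"
  shows "pt_q P i \<mu> = (1, 0)"
  using assms unfolding reconstruction_def by blast

lemma reconstruction_steady:
  assumes "reconstruction N G y P" and "\<forall>i\<in>all_cells N G. steady C (y i)"
    and "i \<in> rec_cells N" and "\<mu> \<in> {1..4}"
  shows "pt_U P i \<mu> + pt_w P i \<mu> = C *\<^sub>R pt_q P i \<mu>" and "snd (pt_U P i \<mu>) = 0"
  using assms unfolding reconstruction_def by blast+

lemma interface_rec_cells:
  assumes "k \<in> interfaces N"
  shows "k \<in> rec_cells N" "k + 1 \<in> rec_cells N"
  using assms by (auto simp: interfaces_def rec_cells_def)

lemma domain_cell_interfaces:
  assumes "i \<in> domain_cells N"
  shows "i \<in> interfaces N" "i - 1 \<in> interfaces N"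
  using assms by (auto simp: domain_cells_def interfaces_def)

text \<open>Both branches of the desingularised formula carry the factor hv, so still water has
  velocity exactly 0, in dry cells too.\<close>

lemma velocity_still: "snd U = 0 \<Longrightarrow> velocity d\<xi> U = 0"
  by (simp add: velocity_def Let_def)

text \<open>For constant q the jump vanishes and the mean is (1, 0), so the mesh flux of q reduces
  to \<open>J_xi_t\<close>, which is the flux in the equation for J. Mesh motion therefore changes
  both averages by the same amount.\<close>

lemma q_defect_rhs:
  assumes rec: "reconstruction N G y P" and q: "\<forall>i\<in>all_cells N G. avg_q (y i) = (1, 0)"
    and i: "i \<in> domain_cells N"
  shows "q_defect (rhs g d\<xi> N G xdot y P i) = 0"
proof -
  have flux: "mesh_flux N xdot P (pt_q P) k = (J_xi_t N xdot P k, 0)" if "k \<in> interfaces N" for k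
    using interface_rec_cells[OF that] reconstruction_q[OF rec q]
    by (simp add: trace_minus_def trace_plus_def mesh_flux_def mean_def jump_def prod_eq_iff)
  show ?thesis
    using domain_cell_interfaces[OF i]
    by (simp add: q_defect_def rhs_def avg_defs rhs_J_def rhs_Jq_def flux prod_eq_iff algebra_simps)
qed

text \<open>Mean and jump are linear, and their coefficients \<open>J_xi_t\<close> and
  \<open>alpha\<close> do not depend on the transported quantity.\<close>

lemma mesh_flux_steady:
  assumes "trace_minus u k + trace_minus w k = C *\<^sub>R trace_minus q k"
    and "trace_plus u k + trace_plus w k = C *\<^sub>R trace_plus q k"
  shows "mesh_flux N xdot P u k + mesh_flux N xdot P w k = C *\<^sub>R mesh_flux N xdot P q k"
proof -
  have "mean u k + mean w k = (1/2) *\<^sub>R ((trace_plus u k + trace_plus w k)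
      + (trace_minus u k + trace_minus w k))"
    by (simp add: mean_def algebra_simps)
  then have "mean u k + mean w k = C *\<^sub>R mean q k"
    unfolding assms by (simp add: mean_def algebra_simps)
  moreover have "jump u k + jump w k = C *\<^sub>R jump q k"
    using assms by (simp add: jump_def algebra_simps)
  moreover have "mesh_flux N xdot P u k + mesh_flux N xdot P w k
      = J_xi_t N xdot P k *\<^sub>R (mean u k + mean w k) - (alpha N xdot / 2) *\<^sub>R (jump u k + jump w k)"
    by (simp add: mesh_flux_def algebra_simps)
  ultimately show ?thesis
    by (simp add: mesh_flux_def algebra_simps)
qed

text \<open>The surface level is C on both sides and the same maximum of b is subtracted from it, so
  the truncated depths agree, also where the truncation gives 0. At zero velocity the dissipation
  then vanishes and only the common pressure is left.\<close>

lemma star_flux_still: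
  assumes "h_minus P k + b_minus P k = C" and "h_plus P k + b_plus P k = C"
    and "snd (trace_minus (pt_U P) k) = 0" and "snd (trace_plus (pt_U P) k) = 0"
  shows "star_flux g d\<xi> N G y P k = (0, g / 2 * (h_star_minus P k)\<^sup>2)"
    and "h_star_plus P k = h_star_minus P k"
proof -
  show eq: "h_star_plus P k = h_star_minus P k"
    using assms by (simp add: h_star_plus_def h_star_minus_def)
  show "star_flux g d\<xi> N G y P k = (0, g / 2 * (h_star_minus P k)\<^sup>2)"
    using assms by (simp add: star_flux_def num_flux_def swe_state_def swe_flux_def velocity_still eq)
qed

text \<open>Expanding the square of h = C - b gives C^2 - 2 C b + b^2, whose constant term drops out
  of the difference. Splitting the source into differences of b and b^2 makes the balance exact for
  bottom jumps of any size.\<close>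

lemma source_balances_pressure:
  fixes g C :: real
  assumes "h1 + b1 = C" and "h2 + b2 = C"
  shows "- g * C * (b1 - b2) + g / 2 * (b1\<^sup>2 - b2\<^sup>2) = g / 2 * h1\<^sup>2 - g / 2 * h2\<^sup>2"
proof -
  have h: "h1 = C - b1" "h2 = C - b2" using assms by auto
  show ?thesis unfolding h by (simp add: power2_eq_square field_simps)
qed

text \<open>The value q = (1, 0) turns the vector relation U + w = C q into surface level C, both at
  the nodes and for the averages.\<close>

lemma steady_defect_rhs:
  assumes rec: "reconstruction N G y P" and q: "\<forall>i\<in>all_cells N G. avg_q (y i) = (1, 0)"
    and st: "\<forall>i\<in>all_cells N G. steady C (y i)" and "G \<ge> 1" and i: "i \<in> domain_cells N"
  shows "steady_defect C (rhs g d\<xi> N G xdot y P i) = 0"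
proof -
  note pt_q = reconstruction_q[OF rec q]
  note pt_steady = reconstruction_steady[OF rec st]
  note ifs = domain_cell_interfaces[OF i]
  have level: "fst (pt_U P l \<mu>) + fst (pt_w P l \<mu>) = C" if "l \<in> rec_cells N" "\<mu> \<in> {1..4}" for l \<mu>
    using arg_cong[OF pt_steady(1)[OF that], of fst] pt_q[OF that] by simp
  have i_all: "i \<in> all_cells N G" and i_rec: "i \<in> rec_cells N"
    using i \<open>G \<ge> 1\<close> by (auto simp: domain_cells_def all_cells_def rec_cells_def)
  have "fst (avg_U (y i)) + fst (avg_w (y i)) = C"
    using arg_cong[of _ _ fst, OF st[rule_format, OF i_all, unfolded steady_def]] q i_all by simp
  then have src1: "src_avg g 1 (y i) = - g * C" and src2: "src_avg g 2 (y i) = g / 2"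
    by (simp_all add: src_avg_def src_def)
  \<comment> \<open>The first source factor is -g C both at the nodes and on average, and the second
    is constant by definition. The quadrature term thus vanishes whatever values \<open>dR\<close>
    takes.\<close>
  have src_eq: "src_pt g m P i \<mu> = src_avg g m (y i)" if "\<mu> \<in> {1..4}" for m \<mu>
    using level[OF i_rec that] \<open>fst (avg_U (y i)) + fst (avg_w (y i)) = C\<close>
    by (simp add: src_pt_def src_avg_def src_def)
  have level_if: "h_minus P k + b_minus P k = C" "h_plus P k + b_plus P k = C"
      "snd (trace_minus (pt_U P) k) = 0" "snd (trace_plus (pt_U P) k) = 0"
    if "k \<in> interfaces N" for k
    using interface_rec_cells[OF that] level pt_steady(2)
    by (simp_all add: trace_minus_def trace_plus_def h_minus_def h_plus_def b_minus_def b_plus_def)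
  have mesh: "mesh_flux N xdot P (pt_U P) k
      = C *\<^sub>R mesh_flux N xdot P (pt_q P) k - mesh_flux N xdot P (pt_w P) k"
    if "k \<in> interfaces N" for k
  proof -
    have "mesh_flux N xdot P (pt_U P) k + mesh_flux N xdot P (pt_w P) k
        = C *\<^sub>R mesh_flux N xdot P (pt_q P) k"
      using interface_rec_cells[OF that] pt_steady(1)
      by (intro mesh_flux_steady) (simp_all add: trace_minus_def trace_plus_def)
    then show ?thesis by (simp add: algebra_simps)
  qed
  \<comment> \<open>The hydrostatic correction replaces the truncated depth in the pressure by the
    trace from inside cell \<open>i\<close>: the minus trace on the right, the plus trace on the
    left.\<close>
  have right: "flux_right g d\<xi> N G xdot y P i
      = mesh_flux N xdot P (pt_U P) i + (0, g / 2 * (h_minus P i)\<^sup>2)"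
    using star_flux_still[OF level_if[OF ifs(1)]] by (simp add: flux_right_def)
  have left: "flux_left g d\<xi> N G xdot y P i
      = mesh_flux N xdot P (pt_U P) (i - 1) + (0, g / 2 * (h_plus P (i - 1))\<^sup>2)"
    using star_flux_still[OF level_if[OF ifs(2)]] by (simp add: flux_left_def)
  have "{1..2::nat} = {1, 2}" by auto
  then have "(\<Sum>m=1..2. src_avg g m (y i) *\<^sub>R (src_R m (b_minus P i) - src_R m (b_plus P (i - 1))))
      = (0, - g * C * (b_minus P i - b_plus P (i - 1))
            + g / 2 * ((b_minus P i)\<^sup>2 - (b_plus P (i - 1))\<^sup>2))"
    by (simp add: src1[simplified] src2 src_R_def)
  also have "\<dots> = (0, g / 2 * (h_minus P i)\<^sup>2 - g / 2 * (h_plus P (i - 1))\<^sup>2)"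
    using source_balances_pressure[OF level_if(1)[OF ifs(1)] level_if(2)[OF ifs(2)], of g] by simp
  finally have source: "(\<Sum>m=1..2. src_avg g m (y i) *\<^sub>R
        (src_R m (b_minus P i) - src_R m (b_plus P (i - 1))))
      = (0, g / 2 * (h_minus P i)\<^sup>2) - (0, g / 2 * (h_plus P (i - 1))\<^sup>2)"
    by simp
  \<comment> \<open>Here \<open>A\<close>, \<open>B\<close> stand for the mesh fluxes of U and
    \<open>p\<close>, \<open>r\<close> for the pressures, right and left; the final 0 is the
    quadrature term.\<close>
  have cancel: "- (e *\<^sub>R (A + p - (B + r))) + e *\<^sub>R (p - r) + 0 = - (e *\<^sub>R (A - B))"
    for A B p r :: vec and e :: real
    by (simp add: algebra_simps)
  \<comment> \<open>Now \<open>A\<close>, \<open>B\<close> are the mesh fluxes of q and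
    \<open>W\<close>, \<open>V\<close> those of w, right and left; those of U are eliminated by
    \<open>mesh\<close>.\<close>
  have combine: "- (e *\<^sub>R (C *\<^sub>R A - W - (C *\<^sub>R B - V))) + - (e *\<^sub>R (W - V))
      = C *\<^sub>R - (e *\<^sub>R (A - B))"
    for A B V W :: vec and e :: real
    by (simp add: prod_eq_iff algebra_simps)
  have quadrature: "(\<Sum>\<mu>=1..4. \<Sum>m=1..2.
      (gl_weight \<mu> * (src_pt g m P i \<mu> - src_avg g m (y i))) *\<^sub>R dR P m i \<mu>) = 0"
    by (intro sum.neutral ballI) (simp add: src_eq)
  have "rhs_JU g d\<xi> N G xdot y P i
      = - ((1/d\<xi>) *\<^sub>R (mesh_flux N xdot P (pt_U P) i - mesh_flux N xdot P (pt_U P) (i - 1)))"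
    unfolding rhs_JU_def source right left quadrature by (rule cancel)
  then have "rhs_JU g d\<xi> N G xdot y P i + rhs_Jw d\<xi> N xdot P i = C *\<^sub>R rhs_Jq d\<xi> N xdot P i"
    unfolding mesh[OF ifs(1)] mesh[OF ifs(2)] rhs_Jw_def rhs_Jq_def by (simp only: combine)
  then show ?thesis
    by (simp add: steady_defect_def rhs_def avg_defs)
qed

section \<open>Propagation through the stages of a time step\<close>

lemma time_step_linear_invariant:
  fixes f :: "averages \<Rightarrow> vec"
  assumes step: "time_step g d\<xi> N G s a c dt xdot P Z y y'" and f: "linear f"
    and init: "\<And>i. i \<in> all_cells N G \<Longrightarrow> f (y i) = 0"
    and rhs: "\<And>l i. l < s \<Longrightarrow> i \<in> domain_cells N \<Longrightarrow> \<forall>j\<in>all_cells N G. f (Z l j) = 0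
      \<Longrightarrow> f (rhs g d\<xi> N G (xdot l) (Z l) (P l) i) = 0"
    and ghosts: "\<And>k. k \<in> {1..s} \<Longrightarrow> \<forall>i\<in>domain_cells N. f (Z k i) = 0
      \<Longrightarrow> \<forall>i\<in>all_cells N G. f (Z k i) = 0"
    and "G \<ge> 1"
  shows "k \<le> s \<Longrightarrow> \<forall>i\<in>all_cells N G. f (Z k i) = 0"
\<comment> \<open>Strong induction, because stage \<open>k\<close> combines all earlier stages and
  their right-hand sides; the linear map \<open>f\<close> kills each summand.\<close>
proof (induction k rule: less_induct)
  case (less k)
  show ?case
  proof (cases "k = 0")
    case True
    then show ?thesis using step init by (simp add: time_step_def)
  next
    case False
    then have k: "k \<in> {1..s}" using less.prems by simp
    have prev: "\<forall>j\<in>all_cells N G. f (Z l j) = 0" if "l < k" for l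
      using less.IH[OF that] that less.prems by simp
    show ?thesis
    \<comment> \<open>The evolution formula covers domain cells only, while later stages ask for the
      invariant in the ghost cells as well.\<close>
    proof (rule ghosts[OF k], rule ballI)
      fix i assume i: "i \<in> domain_cells N"
      then have "i \<in> all_cells N G"
        using \<open>G \<ge> 1\<close> by (auto simp: domain_cells_def all_cells_def)
      have "Z k i = (\<Sum>l<k. a k l *\<^sub>R Z l i
          + (dt * c k l) *\<^sub>R rhs g d\<xi> N G (xdot l) (Z l) (P l) i)"
        using step k i unfolding time_step_def by blast
      then have "f (Z k i) = (\<Sum>l<k. a k l *\<^sub>R f (Z l i)
          + (dt * c k l) *\<^sub>R f (rhs g d\<xi> N G (xdot l) (Z l) (P l) i))"
        by (simp add: linear_sum[OF f] linear_add[OF f] linear_scale[OF f])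
      also have "\<dots> = 0"
        using prev rhs[OF _ i] \<open>i \<in> all_cells N G\<close> less.prems by (intro sum.neutral) simp
      finally show "f (Z k i) = 0" .
    qed
  qed
qed

text \<open>The geometric conservation law involves no steady state, so q stays constant for an
  arbitrary flow.\<close>

lemma time_step_q:
  assumes step: "time_step g d\<xi> N G s a c dt xdot P Z y y'" and "G \<ge> 1"
    and q: "\<And>i. i \<in> all_cells N G \<Longrightarrow> avg_q (y i) = (1, 0)"
    and bc: "\<And>k. k \<in> {1..s} \<Longrightarrow> compatible_ghosts N G C (Z k)"
    and "k \<le> s"
  shows "\<forall>i\<in>all_cells N G. avg_q (Z k i) = (1, 0)"
proof -
  have J: "avg_J (Z k i) > 0" if "k \<le> s" "i \<in> all_cells N G" for k i
    using step that unfolding time_step_def by blast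
  have Z0: "Z 0 i = y i" if "i \<in> all_cells N G" for i
    using step that unfolding time_step_def by blast
  have iff: "q_defect (Z k i) = 0 \<longleftrightarrow> avg_q (Z k i) = (1, 0)"
    if "k \<le> s" "i \<in> all_cells N G" for k i
    using avg_q_eq_iff_q_defect[OF J[OF that]] by simp
  have dom: "i \<in> all_cells N G" if "i \<in> domain_cells N" for i
    using that \<open>G \<ge> 1\<close> by (auto simp: domain_cells_def all_cells_def)
  have "\<forall>i\<in>all_cells N G. q_defect (Z k i) = 0"
  proof (rule time_step_linear_invariant[OF step linear_q_defect _ _ _ \<open>G \<ge> 1\<close> \<open>k \<le> s\<close>])
    show "q_defect (y i) = 0" if "i \<in> all_cells N G" for i
      using iff[of 0 i] Z0 q that by simp
    show "q_defect (rhs g d\<xi> N G (xdot l) (Z l) (P l) i) = 0"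
      if "l < s" "i \<in> domain_cells N" "\<forall>j\<in>all_cells N G. q_defect (Z l j) = 0" for l i
      using step that iff by (intro q_defect_rhs) (auto simp: time_step_def)
    show "\<forall>i\<in>all_cells N G. q_defect (Z k i) = 0"
      if "k \<in> {1..s}" "\<forall>i\<in>domain_cells N. q_defect (Z k i) = 0" for k
      using bc[OF that(1)] that iff dom by (auto simp: compatible_ghosts_def)
  qed
  then show ?thesis using iff \<open>k \<le> s\<close> by simp
qed

lemma time_step_steady:
  assumes step: "time_step g d\<xi> N G s a c dt xdot P Z y y'" and "G \<ge> 1"
    and q: "\<And>i. i \<in> all_cells N G \<Longrightarrow> avg_q (y i) = (1, 0)"
    and st: "\<And>i. i \<in> all_cells N G \<Longrightarrow> steady C (y i)"
    and bc: "\<And>k. k \<in> {1..s} \<Longrightarrow> compatible_ghosts N G C (Z k)"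
    and "k \<le> s"
  shows "\<forall>i\<in>all_cells N G. steady C (Z k i)"
proof -
  have J: "avg_J (Z k i) > 0" if "k \<le> s" "i \<in> all_cells N G" for k i
    using step that unfolding time_step_def by blast
  have Z0: "Z 0 i = y i" if "i \<in> all_cells N G" for i
    using step that unfolding time_step_def by blast
  have iff: "steady_defect C (Z k i) = 0 \<longleftrightarrow> steady C (Z k i)"
    if "k \<le> s" "i \<in> all_cells N G" for k i
    using steady_iff_steady_defect[OF J[OF that]] by simp
  have dom: "i \<in> all_cells N G" if "i \<in> domain_cells N" for i
    using that \<open>G \<ge> 1\<close> by (auto simp: domain_cells_def all_cells_def)
  have "\<forall>i\<in>all_cells N G. steady_defect C (Z k i) = 0"
  proof (rule time_step_linear_invariant[OF step linear_steady_defect _ _ _ \<open>G \<ge> 1\<close> \<open>k \<le> s\<close>])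
    show "steady_defect C (y i) = 0" if "i \<in> all_cells N G" for i
      using iff[of 0 i] Z0 st that by simp
    show "steady_defect C (rhs g d\<xi> N G (xdot l) (Z l) (P l) i) = 0"
      if "l < s" "i \<in> domain_cells N" "\<forall>j\<in>all_cells N G. steady_defect C (Z l j) = 0" for l i
      \<comment> \<open>The relation U + w = C q is propagated together with q = (1, 0), which
        \<open>steady_defect_rhs\<close> needs at stage \<open>l\<close>.\<close>
      using step that iff time_step_q[OF step \<open>G \<ge> 1\<close> q bc, of l] \<open>G \<ge> 1\<close>
      by (intro steady_defect_rhs) (auto simp: time_step_def)
    show "\<forall>i\<in>all_cells N G. steady_defect C (Z k i) = 0"
      if "k \<in> {1..s}" "\<forall>i\<in>domain_cells N. steady_defect C (Z k i) = 0" for k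
      using bc[OF that(1)] that iff dom by (auto simp: compatible_ghosts_def)
  qed
  then show ?thesis using iff \<open>k \<le> s\<close> by simp
qed

theorem theorem3p1:
  fixes g d\<xi> C :: real and N G :: int
    and s n :: nat and a c :: "nat \<Rightarrow> nat \<Rightarrow> real" and dt :: "nat \<Rightarrow> real"
    and xdot :: "nat \<Rightarrow> nat \<Rightarrow> int \<Rightarrow> real"
    and P :: "nat \<Rightarrow> nat \<Rightarrow> point_values"
    and Z :: "nat \<Rightarrow> nat \<Rightarrow> int \<Rightarrow> averages"
    and Y :: "nat \<Rightarrow> int \<Rightarrow> averages"
  assumes "g > 0" and "d\<xi> > 0" and "N \<ge> 1" and "G \<ge> 1"
    and scheme: "forward_euler s a c \<or> ssp_runge_kutta s a c"
    and dt: "\<And>j. j \<le> n \<Longrightarrow> dt j > 0"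
    and q_init: "\<And>i. i \<in> all_cells N G \<Longrightarrow> avg_q (Y 0 i) = (1, 0)"
    and steps: "\<And>j. j \<le> n \<Longrightarrow>
      time_step g d\<xi> N G s a c (dt j) (xdot j) (P j) (Z j) (Y j) (Y (Suc j))"
    and boundary: "\<And>j k. j \<le> n \<Longrightarrow> k \<in> {1..s} \<Longrightarrow> compatible_ghosts N G C (Z j k)"
    and steady_n: "\<And>i. i \<in> all_cells N G \<Longrightarrow> steady C (Y n i)"
  shows "\<forall>i\<in>all_cells N G. steady C (Y (Suc n) i)"
proof -
  \<comment> \<open>This includes the ghost cells: those of the new time level are those of the last
    stage, to which \<open>boundary\<close> applies.\<close>
  have last: "Y (Suc j) i = Z j s i" if "j \<le> n" "i \<in> all_cells N G" for j i
    using steps[OF that(1)] that(2) by (simp add: time_step_def)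
  \<comment> \<open>The steady state is given at level \<open>n\<close> but q = (1, 0) at level 0,
    so q is first carried through all the levels in between.\<close>
  have q: "\<forall>i\<in>all_cells N G. avg_q (Y j i) = (1, 0)" if "j \<le> n" for j
    using that
  proof (induction j)
    case 0
    then show ?case using q_init by simp
  next
    case (Suc j)
    then have "\<forall>i\<in>all_cells N G. avg_q (Z j s i) = (1, 0)"
      by (intro time_step_q[OF steps \<open>G \<ge> 1\<close> _ boundary]) simp_all
    then show ?case using last Suc.prems by simp
  qed
  have "\<forall>i\<in>all_cells N G. steady C (Z n s i)"
    using q[of n] by (intro time_step_steady[OF steps \<open>G \<ge> 1\<close> _ steady_n boundary]) simp_all
  then show ?thesis using last by simp
qed

end
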